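(* Let $G$ be a group, $x\in G$, $n:=o(x)>2$, and let $\alpha\in\{1+x+x^3,\,1+x^2+x^3\}\subset\mathbb{F}_2[G]$ be a zero divisor. Then $n$ must be a multiple of $7$.
   Context: $\mathbb{F}_2$ is the field with two elements. A non-zero element $\alpha\in \mathbb{F}_2[G]$ is called a zero divisor if $\alpha\beta=0$ for some non-zero $\beta\in \mathbb{F}_2[G]$. $o(x)$ denotes the order of $x$, a priori allowed to be infinite; that $n$ is a multiple of $7$ means in particular that $n$ is finite. *)

theory Defs
  imports
    "HOL-Algebra.Multiplicative_Group"
    "HOL-Library.Poly_Mapping"
    "HOL-Library.Extended_Nat"
    "HOL-Library.Z2"
begin

text \<open>
  The library's \<^term>\<open>group.ord\<close> takes the value \<open>0\<close> on elements of infinite order;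
  here infinite order is \<^term>\<open>\<infinity> :: enat\<close>, so that order inequalities read as usual.
\<close>

definition element_order :: "('a, 'm) monoid_scheme \<Rightarrow> 'a \<Rightarrow> enat"
  where "element_order G x = (if group.ord G x = 0 then \<infinity> else enat (group.ord G x))"

lemma (in group) element_order_eq_infinity_iff:
  assumes "x \<in> carrier G"
  shows "element_order G x = \<infinity> \<longleftrightarrow> (\<forall>n::nat. n > 0 \<longrightarrow> x [^] n \<noteq> \<one>)"
  using assms by (simp add: element_order_def ord_eq_0)

lemma (in group) element_order_eq_enat_iff:
  assumes "x \<in> carrier G" "n > 0"
  shows "element_order G x = enat n \<longleftrightarrow>
           x [^] n = \<one> \<and> (\<forall>m::nat. 0 < m \<and> m < n \<longrightarrow> x [^] m \<noteq> \<one>)"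
proof
  assume "element_order G x = enat n"
  then have "ord x = n"
    by (simp add: element_order_def split: if_splits)
  with assms show "x [^] n = \<one> \<and> (\<forall>m::nat. 0 < m \<and> m < n \<longrightarrow> x [^] m \<noteq> \<one>)"
    by (auto simp: pow_eq_id dest: dvd_imp_le)
next
  assume *: "x [^] n = \<one> \<and> (\<forall>m::nat. 0 < m \<and> m < n \<longrightarrow> x [^] m \<noteq> \<one>)"
  then have dvd: "ord x dvd n"
    using assms by (simp add: pow_eq_id)
  with assms have pos: "ord x > 0" and le: "ord x \<le> n"
    by (auto intro: Nat.gr0I dvd_imp_le)
  moreover have "\<not> ord x < n"
    using * pos assms pow_ord_eq_1 by blast
  ultimately show "element_order G x = enat n"
    by (simp add: element_order_def)
qed

text \<open>
  The group ring \<open>R[G]\<close> consists of the finitely supported functions from \<open>G\<close> to \<open>R\<close>, with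
  pointwise addition; \<^term>\<open>Poly_Mapping.single g c\<close> is the formal monomial \<open>c g\<close>. The library's
  own product on \<^typ>\<open>'a \<Rightarrow>\<^sub>0 'r\<close> is not used, since it is the convolution with respect to a
  type-class addition on \<^typ>\<open>'a\<close>.
\<close>

definition group_ring_mult ::
    "('a, 'm) monoid_scheme \<Rightarrow> ('a \<Rightarrow>\<^sub>0 'r::ring_1) \<Rightarrow> ('a \<Rightarrow>\<^sub>0 'r) \<Rightarrow> ('a \<Rightarrow>\<^sub>0 'r)"
  where "group_ring_mult G a b =
    (\<Sum>g\<in>Poly_Mapping.keys a. \<Sum>h\<in>Poly_Mapping.keys b.
       Poly_Mapping.single (g \<otimes>\<^bsub>G\<^esub> h) (Poly_Mapping.lookup a g * Poly_Mapping.lookup b h))"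

definition group_ring :: "('a, 'm) monoid_scheme \<Rightarrow> ('a \<Rightarrow>\<^sub>0 'r::ring_1) ring"
  where "group_ring G =
    \<lparr> carrier = {a. Poly_Mapping.keys a \<subseteq> carrier G},
      mult = group_ring_mult G,
      one = Poly_Mapping.single \<one>\<^bsub>G\<^esub> 1,
      zero = 0,
      add = (+) \<rparr>"

definition group_ring_of :: "'a \<Rightarrow> ('a \<Rightarrow>\<^sub>0 'r::ring_1)"
  where "group_ring_of g = Poly_Mapping.single g 1"

text \<open>Zero divisors are non-zero, and annihilate some non-zero element on their right.\<close>

definition zero_divisor :: "('a, 'm) ring_scheme \<Rightarrow> 'a \<Rightarrow> bool"
  where "zero_divisor R a \<longleftrightarrow>
    a \<in> carrier R - {\<zero>\<^bsub>R\<^esub>} \<and> (\<exists>b \<in> carrier R - {\<zero>\<^bsub>R\<^esub>}. a \<otimes>\<^bsub>R\<^esub> b = \<zero>\<^bsub>R\<^esub>)"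

lemma group_ring_mult_superset:
  assumes "finite A" "finite B" "Poly_Mapping.keys a \<subseteq> A" "Poly_Mapping.keys b \<subseteq> B"
  shows "group_ring_mult G a b =
    (\<Sum>g\<in>A. \<Sum>h\<in>B.
       Poly_Mapping.single (g \<otimes>\<^bsub>G\<^esub> h) (Poly_Mapping.lookup a g * Poly_Mapping.lookup b h))"
proof -
  have "group_ring_mult G a b = (\<Sum>g\<in>Poly_Mapping.keys a. \<Sum>h\<in>B.
       Poly_Mapping.single (g \<otimes>\<^bsub>G\<^esub> h) (Poly_Mapping.lookup a g * Poly_Mapping.lookup b h))"
    unfolding group_ring_mult_def
    by (intro sum.cong refl sum.mono_neutral_left) (use assms in \<open>auto simp: in_keys_iff\<close>)
  also have "\<dots> = (\<Sum>g\<in>A. \<Sum>h\<in>B.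
       Poly_Mapping.single (g \<otimes>\<^bsub>G\<^esub> h) (Poly_Mapping.lookup a g * Poly_Mapping.lookup b h))"
    by (intro sum.mono_neutral_left) (use assms in \<open>auto simp: in_keys_iff\<close>)
  finally show ?thesis .
qed

lemma group_ring_mult_add_left:
  "group_ring_mult G (a + b) c = group_ring_mult G a c + group_ring_mult G b c"
proof -
  let ?A = "Poly_Mapping.keys a \<union> Poly_Mapping.keys b" and ?C = "Poly_Mapping.keys c"
  show ?thesis
    using Poly_Mapping.keys_add[of a b]
    by (simp add: group_ring_mult_superset[of ?A ?C]
      lookup_add distrib_right single_add sum.distrib)
qed

lemma group_ring_mult_add_right:
  "group_ring_mult G c (a + b) = group_ring_mult G c a + group_ring_mult G c b"
proof -
  let ?A = "Poly_Mapping.keys a \<union> Poly_Mapping.keys b" and ?C = "Poly_Mapping.keys c"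
  show ?thesis
    using Poly_Mapping.keys_add[of a b]
    by (simp add: group_ring_mult_superset[of ?C ?A]
      lookup_add distrib_left single_add sum.distrib)
qed

lemma group_ring_mult_zero [simp]:
  "group_ring_mult G 0 a = 0" "group_ring_mult G a 0 = 0"
  by (simp_all add: group_ring_mult_def)

lemma group_ring_mult_single:
  "group_ring_mult G (Poly_Mapping.single g c) (Poly_Mapping.single h d) =
     Poly_Mapping.single (g \<otimes>\<^bsub>G\<^esub> h) (c * d)"
  by (simp add: group_ring_mult_superset[of "{g}" "{h}"])

lemma group_ring_mult_sum_left:
  "group_ring_mult G (sum f A) c = (\<Sum>i\<in>A. group_ring_mult G (f i) c)"
  by (induction A rule: infinite_finite_induct) (auto simp: group_ring_mult_add_left)

lemma group_ring_mult_sum_right: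
  "group_ring_mult G c (sum f A) = (\<Sum>i\<in>A. group_ring_mult G c (f i))"
  by (induction A rule: infinite_finite_induct) (auto simp: group_ring_mult_add_right)

lemma group_ring_sum_monomials:
  "a = (\<Sum>g\<in>Poly_Mapping.keys a. Poly_Mapping.single g (Poly_Mapping.lookup a g))"
  by (rule poly_mapping_eqI) (simp add: lookup_sum lookup_single when_def in_keys_iff)

lemma group_ring_is_ring:
  assumes "group G"
  shows "ring (group_ring G :: ('a \<Rightarrow>\<^sub>0 'r::ring_1) ring)"
proof -
  interpret group G by fact
  let ?C = "{a :: 'a \<Rightarrow>\<^sub>0 'r. Poly_Mapping.keys a \<subseteq> carrier G}"
  let ?s = "\<lambda>a g. Poly_Mapping.single g (Poly_Mapping.lookup a g)"
  have closed: "group_ring_mult G a b \<in> ?C" if "a \<in> ?C" "b \<in> ?C" for a b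
    using that unfolding group_ring_mult_def
    by (fastforce dest!: subsetD[OF keys_sum] split: if_splits)
  have assoc: "group_ring_mult G (group_ring_mult G a b) c =
      group_ring_mult G a (group_ring_mult G b c)"
    if "a \<in> ?C" "b \<in> ?C" "c \<in> ?C" for a b c
  proof -
    have 1: "group_ring_mult G (group_ring_mult G (?s a g) (?s b h)) c =
        group_ring_mult G (?s a g) (group_ring_mult G (?s b h) c)"
      if "g \<in> Poly_Mapping.keys a" "h \<in> Poly_Mapping.keys b" for g h
    proof -
      have "group_ring_mult G (group_ring_mult G (?s a g) (?s b h)) (sum (?s c) (Poly_Mapping.keys c)) =
        group_ring_mult G (?s a g) (group_ring_mult G (?s b h) (sum (?s c) (Poly_Mapping.keys c)))"
        unfolding group_ring_mult_sum_right group_ring_mult_single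
        by (intro sum.cong refl)
          (use that \<open>a \<in> ?C\<close> \<open>b \<in> ?C\<close> \<open>c \<in> ?C\<close> in
            \<open>auto simp: m_assoc mult.assoc subset_iff simp del: not_in_keys_iff_lookup_eq_zero\<close>)
      then show ?thesis
        by (simp flip: group_ring_sum_monomials)
    qed
    have 2: "group_ring_mult G (group_ring_mult G (?s a g) b) c =
        group_ring_mult G (?s a g) (group_ring_mult G b c)"
      if "g \<in> Poly_Mapping.keys a" for g
    proof -
      have "group_ring_mult G (group_ring_mult G (?s a g) (sum (?s b) (Poly_Mapping.keys b))) c =
        group_ring_mult G (?s a g) (group_ring_mult G (sum (?s b) (Poly_Mapping.keys b)) c)"
        unfolding group_ring_mult_sum_right group_ring_mult_sum_left
        by (intro sum.cong refl 1 that)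
      then show ?thesis
        by (simp flip: group_ring_sum_monomials)
    qed
    have "group_ring_mult G (group_ring_mult G (sum (?s a) (Poly_Mapping.keys a)) b) c =
        group_ring_mult G (sum (?s a) (Poly_Mapping.keys a)) (group_ring_mult G b c)"
      unfolding group_ring_mult_sum_left by (intro sum.cong refl 2)
    then show ?thesis
      by (simp flip: group_ring_sum_monomials)
  qed
  have one: "group_ring_mult G (Poly_Mapping.single \<one>\<^bsub>G\<^esub> 1) a = a"
    "group_ring_mult G a (Poly_Mapping.single \<one>\<^bsub>G\<^esub> 1) = a" if "a \<in> ?C" for a
    using that group_ring_sum_monomials[of a]
    by (auto simp: group_ring_mult_def subset_iff)
  show ?thesis
  proof (rule ringI)
    show "abelian_group (group_ring G :: ('a \<Rightarrow>\<^sub>0 'r) ring)"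
    proof (rule abelian_groupI)
      fix x :: "'a \<Rightarrow>\<^sub>0 'r" assume "x \<in> carrier (group_ring G)"
      then show "\<exists>y\<in>carrier (group_ring G). y \<oplus>\<^bsub>group_ring G\<^esub> x = \<zero>\<^bsub>group_ring G\<^esub>"
        by (intro bexI[of _ "- x"]) (auto simp: group_ring_def)
    qed (auto simp: group_ring_def add_ac dest!: subsetD[OF Poly_Mapping.keys_add])
    show "Group.monoid (group_ring G :: ('a \<Rightarrow>\<^sub>0 'r) ring)"
      by (rule monoidI) (use closed assoc one in \<open>auto simp: group_ring_def\<close>)
  qed (auto simp: group_ring_def group_ring_mult_add_left group_ring_mult_add_right)
qed

end

theory Submission
  imports Defs "HOL-Computational_Algebra.Primes"
begin

text \<open>
  Let \<open>\<beta> \<noteq> 0\<close> be annihilated by \<open>\<alpha>\<close>, and let \<open>\<beta>\<close> be non-zero at \<open>g\<close>. Left multiplication by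
  \<open>x\<^sup>k\<close> translates coefficients, so the coefficients \<open>s k = \<beta> (x\<^sup>-\<^sup>k g)\<close> along the orbit of \<open>g\<close>
  satisfy the linear recurrence over the two-element field whose polynomial is \<open>\<alpha>\<close>. Both
  trinomials divide \<open>T\<^sup>7 + 1\<close>, because \<open>T\<^sup>7 + 1 = (T + 1) (T\<^sup>3 + T + 1) (T\<^sup>3 + T\<^sup>2 + 1)\<close>; hence \<open>s\<close> has
  period \<open>7\<close> (lemma \<open>trinomial_recurrence_period_7\<close>).

  If \<open>x\<close> had infinite order, this would give \<open>\<beta>\<close> infinitely many non-zero coefficients, namely
  those at the elements \<open>x\<^sup>-\<^sup>7\<^sup>k g\<close>. So the order \<open>n\<close> of \<open>x\<close> is finite, and it is a second period of
  \<open>s\<close>. If \<open>7\<close> did not divide \<open>n\<close>, the two coprime periods would make \<open>s\<close> constant; but a trinomial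
  has the value \<open>1\<close> at \<open>T = 1\<close>, so that the only constant solution of the recurrence is \<open>0\<close>
  (lemma \<open>trinomial_recurrence_coprime_period\<close>), contrary to \<open>s 0 \<noteq> 0\<close>.
\<close>

lemma periodic_multiple:
  fixes s :: "nat \<Rightarrow> 'b"
  assumes "\<And>k. s (k + p) = s k"
  shows "s (k + p * m) = s k"
  using assms by (induction m) (simp_all add: add.assoc[symmetric] add.commute[of p])

lemma coprime_periods_imp_constant:
  fixes s :: "nat \<Rightarrow> 'b"
  assumes p: "\<And>k. s (k + p) = s k" and q: "\<And>k. s (k + q) = s k"
    and "coprime p q" "p \<noteq> 0"
  shows "s k = s 0"
proof (induction k)
  case (Suc k)
  obtain a b where "p * a = q * b + 1"
    using bezout_nat[OF \<open>p \<noteq> 0\<close>, of q] \<open>coprime p q\<close> by auto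
  then have "s (Suc k) = s (k + p * a)"
    using periodic_multiple[where s = s, OF q, of "Suc k" b] by (simp add: ac_simps)
  also have "\<dots> = s k"
    by (rule periodic_multiple[where s = s, OF p])
  finally show ?case
    using Suc.IH by simp
qed simp

text \<open>
  With the shift operator \<open>T\<close> acting on sequences, the hypothesis says that \<open>1 + T\<^sup>i + T\<^sup>3\<close>
  annihilates \<open>s\<close>, and this polynomial divides \<open>T\<^sup>7 + 1\<close>.
\<close>

lemma trinomial_recurrence_period_7:
  fixes s :: "nat \<Rightarrow> bit"
  assumes rec: "\<And>k. s k + s (k + i) + s (k + 3) = 0" and "i \<in> {1, 2}"
  shows "s (k + 7) = s k"
proof -
  have step: "s (k + 3 + j) = s (k + j) + s (k + i + j)" for j
    using rec[of "k + j"]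
    by (cases "s (k + j)"; cases "s (k + i + j)"; cases "s (k + 3 + j)") (simp_all add: ac_simps)
  \<comment> \<open>Instead of factoring \<open>T\<^sup>7 + 1\<close>, run the recurrence from the eight possible initial triples.\<close>
  show ?thesis
    using \<open>i \<in> {1, 2}\<close> step[of 0] step[of 1] step[of 2] step[of 3] step[of 4]
    by (cases "s k"; cases "s (k + 1)"; cases "s (k + 2)") (auto simp: numeral_eq_Suc)
qed

lemma trinomial_recurrence_coprime_period:
  fixes s :: "nat \<Rightarrow> bit"
  assumes rec: "\<And>k. s k + s (k + i) + s (k + 3) = 0" and i: "i \<in> {1, 2}"
    and "\<And>k. s (k + p) = s k" and "\<not> 7 dvd p"
  shows "s 0 = 0"
proof -
  have "coprime 7 p"
    using \<open>\<not> 7 dvd p\<close> by (intro prime_imp_coprime) simp_all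
  with trinomial_recurrence_period_7[of s, OF rec i] assms(3) have const: "s k = s 0" for k
    by (rule coprime_periods_imp_constant) simp_all
  show ?thesis
    using rec[of 0] const[of i] const[of 3] by (cases "s 0") simp_all
qed

lemma (in group) lookup_monomial_mult:
  fixes b :: "'a \<Rightarrow>\<^sub>0 'r::ring_1"
  assumes "h \<in> carrier G" "k \<in> carrier G" "Poly_Mapping.keys b \<subseteq> carrier G"
  shows "Poly_Mapping.lookup (group_ring_mult G (Poly_Mapping.single h 1) b) k =
    Poly_Mapping.lookup b (inv h \<otimes> k)"
proof -
  have "Poly_Mapping.lookup (group_ring_mult G (Poly_Mapping.single h 1) b) k =
      (\<Sum>l\<in>Poly_Mapping.keys b. if h \<otimes> l = k then Poly_Mapping.lookup b l else 0)"
    by (simp add: group_ring_mult_superset[of "{h}" "Poly_Mapping.keys b"] lookup_sum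
        lookup_single when_def)
  also have "\<dots> = (\<Sum>l\<in>Poly_Mapping.keys b. if inv h \<otimes> k = l then Poly_Mapping.lookup b l else 0)"
    using assms by (intro sum.cong if_cong refl) (auto simp: inv_solve_left' subset_iff)
  also have "\<dots> = Poly_Mapping.lookup b (inv h \<otimes> k)"
    by (simp add: in_keys_iff)
  finally show ?thesis .
qed

text \<open>
  The orbit is traversed by powers of \<open>inv x\<close>, since multiplication by \<open>x\<close> moves the coefficient
  at \<open>inv x \<otimes> g\<close> to \<open>g\<close>.
\<close>

lemma (in group) trinomial_annihilates_imp_recurrence:
  fixes b :: "'a \<Rightarrow>\<^sub>0 'r::ring_1"
  assumes x: "x \<in> carrier G" and g: "g \<in> carrier G" and b: "Poly_Mapping.keys b \<subseteq> carrier G"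
    and zero: "group_ring_mult G (Poly_Mapping.single \<one> 1 + Poly_Mapping.single (x [^] (i::nat)) 1 +
      Poly_Mapping.single (x [^] (j::nat)) 1) b = 0"
  defines "s \<equiv> \<lambda>k::nat. Poly_Mapping.lookup b (inv x [^] k \<otimes> g)"
  shows "s k + s (k + i) + s (k + j) = 0"
proof -
  let ?h = "inv x [^] k \<otimes> g"
  have shift: "Poly_Mapping.lookup (group_ring_mult G (Poly_Mapping.single (x [^] m) 1) b) ?h =
      s (k + m)" for m :: nat
  proof -
    have "inv (x [^] m) \<otimes> ?h = inv x [^] (k + m) \<otimes> g"
      using x g by (simp add: nat_pow_mult add.commute flip: nat_pow_inv m_assoc)
    then show ?thesis
      using x g b by (simp add: lookup_monomial_mult s_def)
  qed
  have "s (k + 0) + s (k + i) + s (k + j) = Poly_Mapping.lookup (group_ring_mult G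
      (Poly_Mapping.single (x [^] (0::nat)) 1 + Poly_Mapping.single (x [^] i) 1 +
        Poly_Mapping.single (x [^] j) 1) b) ?h"
    by (simp only: group_ring_mult_add_left lookup_add shift)
  then show ?thesis
    using zero by simp
qed

text \<open>
  When the order of \<open>x\<close> is infinite, the powers of \<open>x\<close> are distinct, and a non-zero value would
  recur at infinitely many points of the orbit.
\<close>

lemma (in group) periodic_finite_support_imp_finite_order:
  fixes b :: "'a \<Rightarrow>\<^sub>0 'r::zero"
  assumes x: "x \<in> carrier G" and g: "g \<in> carrier G" and nz: "Poly_Mapping.lookup b g \<noteq> 0"
    and per: "\<And>k::nat. Poly_Mapping.lookup b (x [^] (k + p) \<otimes> g) =
      Poly_Mapping.lookup b (x [^] k \<otimes> g)" and "p \<noteq> 0"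
  shows "ord x \<noteq> 0"
proof
  assume "ord x = 0"
  have inj: "inj (\<lambda>k::nat. x [^] k)"
  proof (rule linorder_injI)
    fix k l :: nat
    assume "k < l"
    then have "x [^] (l - k) \<noteq> \<one>"
      using x \<open>ord x = 0\<close> by (simp add: pow_eq_id)
    then show "x [^] k \<noteq> x [^] l"
      using x pow_eq_div2[of x l k] by auto
  qed
  have "inj (\<lambda>m. x [^] (p * m) \<otimes> g)"
    using x g \<open>p \<noteq> 0\<close> by (auto intro!: injI simp: inj_eq[OF inj])
  moreover have "range (\<lambda>m. x [^] (p * m) \<otimes> g) \<subseteq> Poly_Mapping.keys b"
  proof safe
    fix m
    have "Poly_Mapping.lookup b (x [^] (0 + p * m) \<otimes> g) = Poly_Mapping.lookup b (x [^] (0::nat) \<otimes> g)"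
      by (rule periodic_multiple[of "\<lambda>k. Poly_Mapping.lookup b (x [^] k \<otimes> g)", OF per])
    then show "x [^] (p * m) \<otimes> g \<in> Poly_Mapping.keys b"
      using g nz by (simp add: in_keys_iff)
  qed
  ultimately show False
    using finite_subset[OF _ finite_keys] finite_imageD infinite_UNIV_nat by blast
qed

theorem theorem1p6:
  fixes G :: "('a, 'm) monoid_scheme" and x :: 'a and \<alpha> :: "'a \<Rightarrow>\<^sub>0 bit" and n :: enat
  defines "F2G \<equiv> group_ring G :: ('a \<Rightarrow>\<^sub>0 bit) ring"
  assumes "group G"
    and "x \<in> carrier G"
    and "n = element_order G x"
    and "n > 2"
    and "\<alpha> \<in> {\<one>\<^bsub>F2G\<^esub> \<oplus>\<^bsub>F2G\<^esub> group_ring_of x \<oplus>\<^bsub>F2G\<^esub> group_ring_of (x [^]\<^bsub>G\<^esub> (3::nat)),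
              \<one>\<^bsub>F2G\<^esub> \<oplus>\<^bsub>F2G\<^esub> group_ring_of (x [^]\<^bsub>G\<^esub> (2::nat)) \<oplus>\<^bsub>F2G\<^esub> group_ring_of (x [^]\<^bsub>G\<^esub> (3::nat))}"
    and "zero_divisor F2G \<alpha>"
  shows "\<exists>m::nat. n = enat m \<and> 7 dvd m"
proof -
  interpret group G by fact
  note x = \<open>x \<in> carrier G\<close>
  obtain i :: nat where i: "i \<in> {1, 2}" and \<alpha>: "\<alpha> = Poly_Mapping.single \<one>\<^bsub>G\<^esub> 1 +
      Poly_Mapping.single (x [^]\<^bsub>G\<^esub> i) 1 + Poly_Mapping.single (x [^]\<^bsub>G\<^esub> (3::nat)) 1"
  proof -
    have "x [^]\<^bsub>G\<^esub> (1::nat) = x"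
      using x by simp
    with assms(6) that[of 1] that[of 2] show thesis
      unfolding F2G_def by (auto simp: group_ring_def group_ring_of_def)
  qed
  obtain \<beta> where \<beta>: "Poly_Mapping.keys \<beta> \<subseteq> carrier G" "\<beta> \<noteq> 0" "group_ring_mult G \<alpha> \<beta> = 0"
    using \<open>zero_divisor F2G \<alpha>\<close> unfolding F2G_def by (auto simp: zero_divisor_def group_ring_def)
  then obtain g where g: "g \<in> carrier G" and nz: "Poly_Mapping.lookup \<beta> g \<noteq> 0"
    by (metis in_keys_iff lookup_zero poly_mapping_eqI subsetD)
  define s where "s k = Poly_Mapping.lookup \<beta> (inv\<^bsub>G\<^esub> x [^]\<^bsub>G\<^esub> k \<otimes>\<^bsub>G\<^esub> g)" for k :: nat
  have rec: "s k + s (k + i) + s (k + 3) = 0" for k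
    unfolding s_def using \<beta> \<alpha> by (intro trinomial_annihilates_imp_recurrence[OF x g]) simp_all
  have "ord (inv\<^bsub>G\<^esub> x) \<noteq> 0"
    using periodic_finite_support_imp_finite_order[of "inv\<^bsub>G\<^esub> x" g \<beta> 7] x g nz
      trinomial_recurrence_period_7[of s, OF rec i] by (simp add: s_def)
  then have fin: "ord x \<noteq> 0"
    using x by (simp add: ord_inv)
  have "s (k + ord x) = s k" for k
  proof -
    have "inv\<^bsub>G\<^esub> x [^]\<^bsub>G\<^esub> (k + ord x) = inv\<^bsub>G\<^esub> x [^]\<^bsub>G\<^esub> k"
      using x by (simp add: nat_pow_inv flip: nat_pow_mult)
    then show ?thesis
      by (simp add: s_def)
  qed
  then have "7 dvd ord x"
    using trinomial_recurrence_coprime_period[of s, OF rec i] g nz by (auto simp: s_def)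
  with fin show ?thesis
    using \<open>n = element_order G x\<close> by (simp add: element_order_def)
qed

end
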